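(* Let the ruled surfaces $\varphi_e$ and $\varphi_{e_1}$ form a Mannheim surface offset, with offset distance $\theta^*$. Then $\varphi_e$ is developable if and only if $\theta^*=c^*=\text{constant}$, where $c^*:=\theta^*(0)$ (i.e. if and only if the function $\theta^*$ is constant, equal to the real number $c^*$).
   Context: Dual numbers: $D=\{a+\varepsilon a^*: a,a^*\in\mathbb{R}\}$ with $\varepsilon^2=0$. A differentiable real function $f$ extends to $D$ by $f(x+\varepsilon x^* )=f(x)+\varepsilon x^* f'(x)$; in particular this defines $\sin$, $\cos$. Dual vectors are $\tilde a=\vec a+\varepsilon\vec a^*$ with $\vec a,\vec a^*\in\mathbb{R}^3$; scalar and cross products are extended $D$-bilinearly. Ruled surface: all functions are smooth. $\varphi_e(s,v)=\vec c(s)+v\,\vec e(s)$, $s$ in an open interval containing $0$, where $\langle\vec e,\vec e\rangle=1$, $s$ is the arc-length of the spherical curve $\vec e$, i.e. $\langle\vec e\,',\vec e\,'\rangle=1$, and $\vec c$ is the striction curve, i.e. $\langle\vec c\,',\vec e\,'\rangle=0$ (prime $=d/ds$). Put $\vec t=\vec e\,'$, $\vec g=\vec e\times\vec t$. The conical curvature $\gamma$ is defined by $\vec t\,'=\gamma\vec g-\vec e$ (so $\vec g\,'=-\gamma\vec t$). Put $\Delta=\det(\vec c\,',\vec e,\vec t)$. The surface $\varphi_e$ is developable means $\Delta=0$ identically. The ruled surface is represented by the dual unit vector $\tilde e=\vec e+\varepsilon\,\vec c\times\vec e$; its dual Darboux frame is $\{\tilde e,\tilde t,\tilde g\}$ with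 $\tilde t=\vec t+\varepsilon\,\vec c\times\vec t$, $\tilde g=\vec g+\varepsilon\,\vec c\times\vec g$. A second ruled surface $\varphi_{e_1}$ is given in the same way; the same symbols with index $1$ ($s_1,\vec c_1,\vec e_1,\vec t_1,\vec g_1,\gamma_1,\Delta_1,\tilde e_1,\tilde t_1,\tilde g_1$) denote its corresponding objects, with derivatives taken with respect to $s_1$. Mannheim surface offset: $\varphi_e$ and $\varphi_{e_1}$ are Mannheim surface offsets if there is a one-to-one correspondence $s\mapsto s_1(s)$ between their rulings (smooth, with $ds_1/ds\neq0$) such that $\tilde g=\tilde t_1$ at corresponding parameters. Then the frames are related by $\tilde e_1=\cos\bar\theta\,\tilde e+\sin\bar\theta\,\tilde t$, $\tilde t_1=\tilde g$, $\tilde g_1=\sin\bar\theta\,\tilde e-\cos\bar\theta\,\tilde t$, where $\bar\theta=\theta+\varepsilon\theta^*$ (a smooth function of $s$, with $0\le\theta\le\pi$, $\theta^*\in\mathbb{R}$) is the dual angle between $\tilde e$ and $\tilde e_1$, called the dual offset angle; $\theta$ is the offset angle and $\theta^*$ the offset distance. *)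

theory Defs
  imports "HOL-Analysis.Analysis"
begin

text \<open>
  Dual numbers are elements of \<open>real dual\<close> and dual vectors are elements of \<open>(real^3) dual\<close>;
  \<open>Dual a b\<close> stands for \<open>a + \<epsilon> b\<close> with \<open>\<epsilon> * \<epsilon> = 0\<close>.
\<close>

datatype 'a dual = Dual (re: 'a) (du: 'a)

instantiation dual :: (plus) plus
begin

definition plus_dual :: "'a dual \<Rightarrow> 'a dual \<Rightarrow> 'a dual" where
  "x + y = Dual (re x + re y) (du x + du y)"

instance ..

end

definition dual_scale :: "real dual \<Rightarrow> 'a::real_vector dual \<Rightarrow> 'a dual" where
  "dual_scale x v = Dual (re x *\<^sub>R re v) (re x *\<^sub>R du v + du x *\<^sub>R re v)"

definition dual_ext :: "(real \<Rightarrow> real) \<Rightarrow> real dual \<Rightarrow> real dual" where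
  "dual_ext f x = Dual (f (re x)) (du x * deriv f (re x))"

text \<open>Infinite differentiability; only to be used on open sets \<open>S\<close>.\<close>

definition vderiv :: "(real \<Rightarrow> 'a::real_normed_vector) \<Rightarrow> real \<Rightarrow> 'a" where
  "vderiv f s = vector_derivative f (at s)"

definition smooth_on :: "real set \<Rightarrow> (real \<Rightarrow> 'a::real_normed_vector) \<Rightarrow> bool" where
  "smooth_on S f \<longleftrightarrow> (\<forall>n. \<forall>s\<in>S. ((vderiv ^^ n) f) differentiable (at s))"

text \<open>
  The data of a parametrised ruled surface \<open>(s, v) \<mapsto> striction s + v *\<^sub>R director s\<close>, with \<open>s\<close>
  ranging over \<open>params\<close> and \<open>v\<close> over the reals. The values of the two curves outside \<open>params\<close>
  are irrelevant.
\<close>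

record ruled_surface =
  params :: "real set"
  striction :: "real \<Rightarrow> real^3"
  director :: "real \<Rightarrow> real^3"

definition tangent_vec :: "ruled_surface \<Rightarrow> real \<Rightarrow> real^3" where
  "tangent_vec R = vderiv (director R)"

definition central_vec :: "ruled_surface \<Rightarrow> real \<Rightarrow> real^3" where
  "central_vec R s = cross3 (director R s) (tangent_vec R s)"

text \<open>
  The conditions on the director say that it is a spherical curve parametrised by arc length;
  the last condition says that the base curve is the striction curve.
\<close>

definition is_ruled_surface :: "ruled_surface \<Rightarrow> bool" where
  "is_ruled_surface R \<longleftrightarrow>
     open (params R) \<and> is_interval (params R) \<and> 0 \<in> params R \<and>
     smooth_on (params R) (striction R) \<and> smooth_on (params R) (director R) \<and>
     (\<forall>s\<in>params R.
        director R s \<bullet> director R s = 1 \<and>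
        vderiv (director R) s \<bullet> vderiv (director R) s = 1 \<and>
        vderiv (striction R) s \<bullet> vderiv (director R) s = 0)"

definition Delta :: "ruled_surface \<Rightarrow> real \<Rightarrow> real" where
  "Delta R s = det (vector [vderiv (striction R) s, director R s, tangent_vec R s] :: real^3^3)"

definition developable :: "ruled_surface \<Rightarrow> bool" where
  "developable R \<longleftrightarrow> (\<forall>s\<in>params R. Delta R s = 0)"

text \<open>The oriented line with unit direction \<open>x\<close> through the point \<open>c\<close>, as a dual unit vector.\<close>

definition dual_line :: "real^3 \<Rightarrow> real^3 \<Rightarrow> (real^3) dual" where
  "dual_line c x = Dual x (cross3 c x)"

definition dual_e :: "ruled_surface \<Rightarrow> real \<Rightarrow> (real^3) dual" where
  "dual_e R s = dual_line (striction R s) (director R s)"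

definition dual_t :: "ruled_surface \<Rightarrow> real \<Rightarrow> (real^3) dual" where
  "dual_t R s = dual_line (striction R s) (tangent_vec R s)"

definition dual_g :: "ruled_surface \<Rightarrow> real \<Rightarrow> (real^3) dual" where
  "dual_g R s = dual_line (striction R s) (central_vec R s)"

text \<open>
  \<open>R\<close> and \<open>R1\<close> are Mannheim surface offsets if \<open>mannheim_offset R R1 \<sigma>\<close> holds for some
  correspondence \<open>\<sigma>\<close>, which sends the parameter \<open>s\<close> of a ruling of \<open>R\<close> to the parameter \<open>s1\<close>
  of the corresponding ruling of \<open>R1\<close>.
\<close>

definition mannheim_offset :: "ruled_surface \<Rightarrow> ruled_surface \<Rightarrow> (real \<Rightarrow> real) \<Rightarrow> bool" where
  "mannheim_offset R R1 \<sigma> \<longleftrightarrow>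
     is_ruled_surface R \<and> is_ruled_surface R1 \<and>
     bij_betw \<sigma> (params R) (params R1) \<and> smooth_on (params R) \<sigma> \<and>
     (\<forall>s\<in>params R. deriv \<sigma> s \<noteq> 0 \<and> dual_g R s = dual_t R1 (\<sigma> s))"

text \<open>
  The dual angle \<open>\<theta> + \<epsilon> \<theta>s\<close> between corresponding rulings. For a Mannheim offset, the analogous
  formula for the third frame vector, \<open>dual_g R1 (\<sigma> s)\<close>, need not be required: it follows by
  taking the dual cross product of \<open>dual_e R1 (\<sigma> s)\<close> with \<open>dual_t R1 (\<sigma> s) = dual_g R s\<close>.
\<close>

definition dual_offset_angle ::
  "ruled_surface \<Rightarrow> ruled_surface \<Rightarrow> (real \<Rightarrow> real) \<Rightarrow> (real \<Rightarrow> real) \<Rightarrow> (real \<Rightarrow> real) \<Rightarrow> bool" where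
  "dual_offset_angle R R1 \<sigma> \<theta> \<theta>s \<longleftrightarrow>
     smooth_on (params R) \<theta> \<and> smooth_on (params R) \<theta>s \<and>
     (\<forall>s\<in>params R.
        0 \<le> \<theta> s \<and> \<theta> s \<le> pi \<and>
        dual_e R1 (\<sigma> s) =
          dual_scale (dual_ext cos (Dual (\<theta> s) (\<theta>s s))) (dual_e R s) +
          dual_scale (dual_ext sin (Dual (\<theta> s) (\<theta>s s))) (dual_t R s))"

end

theory Submission
  imports Defs
begin

text \<open>
  Write \<open>c\<close>, \<open>e\<close>, \<open>t\<close>, \<open>g\<close> for the striction curve and the Darboux frame of the first surface, and
  \<open>c\<^sub>1\<close>, \<open>e\<^sub>1\<close>, \<open>t\<^sub>1\<close>, \<open>g\<^sub>1\<close> for those of the second one at corresponding parameters. The dual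
  condition on the frames says that the oriented line along \<open>g\<close> through \<open>c\<close> is the oriented line
  along \<open>t\<^sub>1\<close> through \<open>c\<^sub>1\<close>. Hence \<open>c\<^sub>1 - c\<close> is a multiple of \<open>g\<close>, and comparing the moments of the
  two rulings identifies the factor as the offset distance: \<open>c\<^sub>1 = c + \<theta>\<^sup>* g\<close>
  (\<open>offset_distance_eq\<close>).

  Differentiate \<open>\<theta>\<^sup>* = (c\<^sub>1 - c) \<bullet> g\<close>. The term with \<open>c\<^sub>1'\<close> vanishes, because \<open>c\<^sub>1\<close> is a striction
  curve and \<open>g = t\<^sub>1\<close>; the term with \<open>g'\<close> vanishes, because \<open>c\<^sub>1 - c\<close> is parallel to the unit
  vector \<open>g\<close>. What remains is \<open>\<theta>\<^sup>*' = - c' \<bullet> g = - \<Delta>\<close> (\<open>offset_distance_deriv\<close>). So \<open>\<Delta>\<close> vanishes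
  identically if and only if \<open>\<theta>\<^sup>*\<close> is constant on the parameter interval.
\<close>

lemma smooth_on_imp_has_vector_derivative:
  assumes "smooth_on S f" "s \<in> S"
  shows "(f has_vector_derivative vderiv f s) (at s)"
    and "(vderiv f has_vector_derivative vderiv (vderiv f) s) (at s)"
proof -
  have "((vderiv ^^ 0) f) differentiable (at s)" "((vderiv ^^ 1) f) differentiable (at s)"
    using assms unfolding smooth_on_def by blast+
  then show "(f has_vector_derivative vderiv f s) (at s)"
    and "(vderiv f has_vector_derivative vderiv (vderiv f) s) (at s)"
    by (simp_all add: vderiv_def vector_derivative_works)
qed

lemma inner_deriv_self_eq_0:
  fixes f :: "real \<Rightarrow> 'a::real_inner"
  assumes "open S" "s \<in> S" "\<And>x. x \<in> S \<Longrightarrow> f x \<bullet> f x = k"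
    and f: "(f has_vector_derivative f') (at s)"
  shows "f s \<bullet> f' = 0"
proof -
  have "((\<lambda>x. f x \<bullet> f x) has_vector_derivative f s \<bullet> f' + f' \<bullet> f s) (at s)"
    by (rule bounded_bilinear.has_vector_derivative[OF bounded_bilinear_inner f f])
  moreover have "((\<lambda>x. f x \<bullet> f x) has_vector_derivative 0) (at s)"
    by (rule has_vector_derivative_transform_within_open[where f = "\<lambda>_. k" and S = S])
      (use assms in auto)
  ultimately show ?thesis
    using vector_derivative_unique_at by (fastforce simp: inner_commute)
qed

lemma bounded_bilinear_cross3: "bounded_bilinear cross3"
  using bilinear_cross bilinear_conv_bounded_bilinear by blast

context
  fixes R s assumes R: "is_ruled_surface R" and s: "s \<in> params R"
begin

lemma frame_inner:
  shows "director R s \<bullet> director R s = 1"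
    and "tangent_vec R s \<bullet> tangent_vec R s = 1"
    and "director R s \<bullet> tangent_vec R s = 0"
proof -
  show "director R s \<bullet> director R s = 1" "tangent_vec R s \<bullet> tangent_vec R s = 1"
    using R s by (auto simp: is_ruled_surface_def tangent_vec_def)
  have "(director R has_vector_derivative tangent_vec R s) (at s)"
    using R s smooth_on_imp_has_vector_derivative
    by (auto simp: is_ruled_surface_def tangent_vec_def)
  then show "director R s \<bullet> tangent_vec R s = 0"
    using R s by (intro inner_deriv_self_eq_0[where S = "params R"]) (auto simp: is_ruled_surface_def)
qed

lemma central_vec_unit: "central_vec R s \<bullet> central_vec R s = 1"
  using frame_inner by (simp add: central_vec_def dot_cross inner_commute)

lemma central_vec_cross:
  "cross3 (central_vec R s) (director R s) = tangent_vec R s"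
  "cross3 (central_vec R s) (tangent_vec R s) = - director R s"
proof -
  have *: "cross3 (cross3 x y) z = (x \<bullet> z) *\<^sub>R y - (y \<bullet> z) *\<^sub>R x" for x y z
    using cross_skew[of "cross3 x y" z] by (simp only: Lagrange minus_diff_eq inner_commute)
  show "cross3 (central_vec R s) (director R s) = tangent_vec R s"
    "cross3 (central_vec R s) (tangent_vec R s) = - director R s"
    using frame_inner by (simp_all add: central_vec_def * inner_commute)
qed

lemma Delta_eq: "Delta R s = vderiv (striction R) s \<bullet> central_vec R s"
  by (simp add: Delta_def central_vec_def dot_cross_det)

lemma central_vec_differentiable:
  "\<exists>g'. (central_vec R has_vector_derivative g') (at s)"
proof -
  have "(director R has_vector_derivative vderiv (director R) s) (at s)"
    "(tangent_vec R has_vector_derivative vderiv (tangent_vec R) s) (at s)"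
    using R s smooth_on_imp_has_vector_derivative
    by (auto simp: is_ruled_surface_def tangent_vec_def)
  from bounded_bilinear.has_vector_derivative[OF bounded_bilinear_cross3 this]
  show ?thesis
    unfolding central_vec_def[abs_def] by blast
qed

end

lemma parallel_if_cross3_eq_0:
  assumes "cross3 w g = 0" "g \<bullet> g = 1"
  shows "w = (w \<bullet> g) *\<^sub>R g"
  using assms Lagrange[of g w g] by (simp add: inner_commute)

text \<open>
  The dual parts of the two hypotheses compare moments about the origin. Equal moments along the
  common line make \<open>w = c\<^sub>1 - c\<close> a multiple of \<open>g\<close>. The moment of \<open>e\<^sub>1\<close> about \<open>c\<close> is then \<open>w \<bullet> g\<close> times
  the unit vector \<open>n = g \<times> e\<^sub>1 = cos \<theta> t - sin \<theta> e\<close>, and since \<open>n\<close> is also the derivative of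
  \<open>cos \<theta> e + sin \<theta> t\<close> with respect to \<open>\<theta>\<close>, the dual part of the offset angle prescribes this
  moment as \<open>\<theta>\<^sup>* n\<close>.
\<close>
lemma offset_distance_eq:
  assumes M: "mannheim_offset R R1 \<sigma>" and A: "dual_offset_angle R R1 \<sigma> \<theta> \<theta>s"
    and s: "s \<in> params R"
  defines "w \<equiv> striction R1 (\<sigma> s) - striction R s"
  shows "w = \<theta>s s *\<^sub>R central_vec R s" and "\<theta>s s = w \<bullet> central_vec R s"
proof -
  let ?e = "director R s" and ?t = "tangent_vec R s" and ?g = "central_vec R s"
    and ?e1 = "director R1 (\<sigma> s)"
  let ?n = "cos (\<theta> s) *\<^sub>R ?t - sin (\<theta> s) *\<^sub>R ?e"
  have R: "is_ruled_surface R" and "dual_g R s = dual_t R1 (\<sigma> s)"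
    using M s by (auto simp: mannheim_offset_def)
  then have "cross3 (striction R s) ?g = cross3 (striction R1 (\<sigma> s)) ?g"
    by (auto simp: dual_g_def dual_t_def dual_line_def)
  then have "cross3 w ?g = 0"
    by (simp add: w_def Cross3.left_diff_distrib)
  then have w: "w = (w \<bullet> ?g) *\<^sub>R ?g"
    by (rule parallel_if_cross3_eq_0) (rule central_vec_unit[OF R s])
  have "deriv cos x = - sin x" "deriv sin x = cos x" for x :: real
    by (auto intro!: DERIV_imp_deriv derivative_eq_intros)
  then have e1: "?e1 = cos (\<theta> s) *\<^sub>R ?e + sin (\<theta> s) *\<^sub>R ?t"
    and "cross3 (striction R1 (\<sigma> s)) ?e1 =
      cos (\<theta> s) *\<^sub>R cross3 (striction R s) ?e + (\<theta>s s * - sin (\<theta> s)) *\<^sub>R ?e +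
      (sin (\<theta> s) *\<^sub>R cross3 (striction R s) ?t + (\<theta>s s * cos (\<theta> s)) *\<^sub>R ?t)"
    using A s
    by (auto simp: dual_offset_angle_def dual_e_def dual_t_def dual_line_def dual_scale_def
        dual_ext_def plus_dual_def)
  then have m1: "cross3 (striction R1 (\<sigma> s)) ?e1 = cross3 (striction R s) ?e1 + \<theta>s s *\<^sub>R ?n"
    by (simp add: cross_add_right cross_mult_right scaleR_diff_right)
  have "\<theta>s s *\<^sub>R ?n = cross3 w ?e1"
    using m1 by (simp add: w_def Cross3.left_diff_distrib)
  also have "\<dots> = (w \<bullet> ?g) *\<^sub>R cross3 ?g ?e1"
    using arg_cong[OF w, of "\<lambda>v. cross3 v ?e1"] by (simp only: cross_mult_left)
  also have "cross3 ?g ?e1 = ?n"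
    by (simp add: e1 cross_add_right cross_mult_right central_vec_cross[OF R s])
  finally have n: "\<theta>s s *\<^sub>R ?n = (w \<bullet> ?g) *\<^sub>R ?n" .
  have "?n \<bullet> ?n = (cos (\<theta> s))\<^sup>2 + (sin (\<theta> s))\<^sup>2"
    using frame_inner[OF R s]
    by (simp add: inner_diff_left inner_diff_right inner_commute power2_eq_square)
  then have "?n \<noteq> 0"
    by fastforce
  with n show "\<theta>s s = w \<bullet> ?g"
    by (simp add: real_vector.scale_right_imp_eq)
  with w show "w = \<theta>s s *\<^sub>R ?g"
    by simp
qed

lemma offset_distance_deriv:
  assumes M: "mannheim_offset R R1 \<sigma>" and A: "dual_offset_angle R R1 \<sigma> \<theta> \<theta>s"
    and s: "s \<in> params R"
  shows "(\<theta>s has_real_derivative - Delta R s) (at s)"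
proof -
  let ?c1 = "striction R1" and ?w = "\<lambda>x. striction R1 (\<sigma> x) - striction R x"
  have R: "is_ruled_surface R" and R1: "is_ruled_surface R1" and s1: "\<sigma> s \<in> params R1"
    and "dual_g R s = dual_t R1 (\<sigma> s)" and \<sigma>_smooth: "smooth_on (params R) \<sigma>"
    using M s by (auto simp: mannheim_offset_def dest: bij_betwE)
  then have gt1: "central_vec R s = vderiv (director R1) (\<sigma> s)"
    by (simp add: dual_g_def dual_t_def dual_line_def tangent_vec_def)
  have c: "(striction R has_vector_derivative vderiv (striction R) s) (at s)"
    and c1: "(?c1 has_vector_derivative vderiv ?c1 (\<sigma> s)) (at (\<sigma> s))"
    using R R1 s s1 smooth_on_imp_has_vector_derivative by (auto simp: is_ruled_surface_def)
  have "(\<sigma> has_vector_derivative vderiv \<sigma> s) (at s)"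
    using \<sigma>_smooth s by (rule smooth_on_imp_has_vector_derivative)
  from vector_diff_chain_at[OF this c1] c
  have w: "(?w has_vector_derivative
      vderiv \<sigma> s *\<^sub>R vderiv ?c1 (\<sigma> s) - vderiv (striction R) s) (at s)"
    by (auto simp: o_def intro: has_vector_derivative_diff)
  obtain g' where g: "(central_vec R has_vector_derivative g') (at s)"
    using central_vec_differentiable[OF R s] by blast
  have "central_vec R s \<bullet> g' = 0"
    using R s g central_vec_unit[OF R]
    by (intro inner_deriv_self_eq_0[where S = "params R"]) (auto simp: is_ruled_surface_def)
  then have "?w s \<bullet> g' = 0"
    by (simp add: offset_distance_eq(1)[OF M A s])
  moreover have "vderiv ?c1 (\<sigma> s) \<bullet> central_vec R s = 0"
    using R1 s1 by (simp add: gt1 is_ruled_surface_def)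
  ultimately have "((\<lambda>x. ?w x \<bullet> central_vec R x) has_vector_derivative - Delta R s) (at s)"
    using bounded_bilinear.has_vector_derivative[OF bounded_bilinear_inner w g]
    by (simp add: Delta_eq[OF R s] inner_diff_left)
  then have "(\<theta>s has_vector_derivative - Delta R s) (at s)"
    by (rule has_vector_derivative_transform_within_open[where S = "params R"])
      (use R s offset_distance_eq(2)[OF M A] in \<open>auto simp: is_ruled_surface_def\<close>)
  then show ?thesis
    by (simp add: has_real_derivative_iff_has_vector_derivative)
qed

theorem corollary3p1:
  fixes R R1 :: ruled_surface and \<sigma> \<theta> \<theta>s :: "real \<Rightarrow> real"
  assumes "mannheim_offset R R1 \<sigma>"
    and "dual_offset_angle R R1 \<sigma> \<theta> \<theta>s"
  shows "developable R \<longleftrightarrow> (\<forall>s\<in>params R. \<theta>s s = \<theta>s 0)"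
proof -
  have I: "open (params R)" "convex (params R)" "0 \<in> params R"
    using assms(1) by (auto simp: mannheim_offset_def is_ruled_surface_def is_interval_convex)
  note D = offset_distance_deriv[OF assms]
  show ?thesis
  proof
    assume "developable R"
    then have "(\<theta>s has_real_derivative 0) (at s within params R)" if "s \<in> params R" for s
      using D[OF that] that by (auto simp: developable_def intro: has_field_derivative_at_within)
    then obtain k where "\<And>s. s \<in> params R \<Longrightarrow> \<theta>s s = k"
      using has_field_derivative_zero_constant[OF I(2)] by blast
    then show "\<forall>s\<in>params R. \<theta>s s = \<theta>s 0"
      using I(3) by simp
  next
    assume const: "\<forall>s\<in>params R. \<theta>s s = \<theta>s 0"
    have "Delta R s = 0" if s: "s \<in> params R" for s
    proof -
      have "(\<theta>s has_real_derivative 0) (at s)"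
        by (rule has_field_derivative_transform_within_open[where f = "\<lambda>_. \<theta>s 0" and S = "params R"])
          (use I s const in \<open>blast intro: DERIV_const sym\<close>)+
      then show ?thesis
        using DERIV_unique D[OF s] by fastforce
    qed
    then show "developable R"
      by (simp add: developable_def)
  qed
qed

end
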